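(* The infinite Queen graph has either $\alpha_{\mathrm{od}}=\infty$ or $\alpha_{\mathrm{od}}=1$; no other finite value is possible.
   Context: The infinite Queen graph has vertex set $\mathbb{Z}^2$; two distinct vertices $(a,b),(a',b')$ are adjacent iff $a=a'$, or $b=b'$, or $a-a'=b-b'$, or $a-a'=b'-b$. $N(v)$ is the open neighborhood of $v$. An odd independent set is an independent set $S$ of vertices such that every vertex $v\notin S$ has either $N(v)\cap S=\varnothing$ or $|N(v)\cap S|$ odd (note that $|N(v)\cap S|$ is always finite here, since $N(v)$ is covered by four cliques). $\alpha_{\mathrm{od}}$ is the largest cardinality of an odd independent set, taken to be $\infty$ if there is no finite maximum. *)

theory Defs
  imports Main "HOL-Library.Extended_Nat"
begin

text \<open>A simple graph, possibly infinite, is given by its vertex set \<open>V\<close> and its adjacency relation \<open>E\<close>,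
  which is understood to be irreflexive and symmetric.\<close>

definition open_neighborhood :: "'a set \<Rightarrow> ('a \<Rightarrow> 'a \<Rightarrow> bool) \<Rightarrow> 'a \<Rightarrow> 'a set" where
  "open_neighborhood V E v = {u \<in> V. E v u}"

definition independent_set :: "'a set \<Rightarrow> ('a \<Rightarrow> 'a \<Rightarrow> bool) \<Rightarrow> 'a set \<Rightarrow> bool" where
  "independent_set V E S \<longleftrightarrow> S \<subseteq> V \<and> (\<forall>u\<in>S. \<forall>v\<in>S. \<not> E u v)"

text \<open>Since \<open>card\<close> of an infinite set is \<open>0\<close>, a vertex outside \<open>S\<close> with infinitely many neighbours
  in \<open>S\<close> violates the condition below. In the Queen graph such vertices do not exist,
  see \<open>queen_neighborhood_finite\<close>.\<close>

definition odd_independent_set :: "'a set \<Rightarrow> ('a \<Rightarrow> 'a \<Rightarrow> bool) \<Rightarrow> 'a set \<Rightarrow> bool" where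
  "odd_independent_set V E S \<longleftrightarrow>
     independent_set V E S \<and>
     (\<forall>v \<in> V - S. open_neighborhood V E v \<inter> S = {} \<or> odd (card (open_neighborhood V E v \<inter> S)))"

definition ecard :: "'a set \<Rightarrow> enat" where
  "ecard S = (if finite S then enat (card S) else \<infinity>)"

text \<open>A supremum in \<open>enat\<close> is either attained or infinite, so this is the maximum cardinality
  if there is a finite one, and \<open>\<infinity>\<close> otherwise.\<close>

definition odd_independence_number :: "'a set \<Rightarrow> ('a \<Rightarrow> 'a \<Rightarrow> bool) \<Rightarrow> enat" where
  "odd_independence_number V E = (SUP S \<in> {S. odd_independent_set V E S}. ecard S)"

definition queen_vertices :: "(int \<times> int) set" where
  "queen_vertices = UNIV"

fun queen_adj :: "int \<times> int \<Rightarrow> int \<times> int \<Rightarrow> bool" where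
  "queen_adj (a, b) (a', b') \<longleftrightarrow>
     (a, b) \<noteq> (a', b') \<and> (a = a' \<or> b = b' \<or> a - a' = b - b' \<or> a - a' = b' - b)"

lemma queen_adj_irrefl: "\<not> queen_adj v v"
  by (cases v) simp

lemma queen_adj_sym: "queen_adj u v \<Longrightarrow> queen_adj v u"
  by (cases u; cases v) auto

lemma queen_neighborhood_finite:
  assumes "independent_set queen_vertices queen_adj S"
  shows "finite (open_neighborhood queen_vertices queen_adj v \<inter> S)"
proof -
  obtain a b where v: "v = (a, b)" by (cases v)
  have ind: "u = w" if "u \<in> S" "w \<in> S" "fst u = fst w \<or> snd u = snd w \<or> fst u - snd u = fst w - snd w \<or> fst u + snd u = fst w + snd w" for u w
    using assms that unfolding independent_set_def by (cases u; cases w) fastforce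
  have one: "finite {u \<in> S. f u = c}"
    if "\<And>u w. u \<in> S \<Longrightarrow> w \<in> S \<Longrightarrow> f u = f w \<Longrightarrow> u = w" for f :: "int \<times> int \<Rightarrow> int" and c
  proof -
    have "inj_on f {u \<in> S. f u = c}" using that by (auto intro!: inj_onI)
    moreover have "f ` {u \<in> S. f u = c} \<subseteq> {c}" by auto
    ultimately show ?thesis by (meson finite.simps finite_imageD finite_subset)
  qed
  have "open_neighborhood queen_vertices queen_adj v \<inter> S \<subseteq>
      {u \<in> S. fst u = a} \<union> {u \<in> S. snd u = b} \<union>
      {u \<in> S. fst u - snd u = a - b} \<union> {u \<in> S. fst u + snd u = a + b}"
    by (auto simp: open_neighborhood_def v)
  moreover have "finite \<dots>"
    by (intro finite_UnI one; use ind in blast)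
  ultimately show ?thesis by (rule finite_subset)
qed

lemma odd_independence_number_attained:
  assumes "odd_independence_number V E \<noteq> \<infinity>"
  shows "\<exists>S. odd_independent_set V E S \<and> finite S \<and> odd_independence_number V E = enat (card S)"
proof -
  let ?A = "ecard ` {S. odd_independent_set V E S}"
  have "odd_independent_set V E {}"
    by (simp add: odd_independent_set_def independent_set_def)
  then have ne: "?A \<noteq> {}" by blast
  then have "finite ?A" and "Sup ?A = Max ?A"
    using assms unfolding odd_independence_number_def Sup_enat_def by (auto split: if_splits)
  then have "odd_independence_number V E \<in> ?A"
    using ne Max_in unfolding odd_independence_number_def by metis
  then show ?thesis using assms by (auto simp: ecard_def split: if_splits)
qed

end

theory Submission
  imports Defs
begin

text \<open>The proof shows that a \<^emph>\<open>finite\<close> odd independent set has at most one element; as a singleton is odd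
  independent, the odd independence number is then \<open>1\<close> unless an infinite odd independent set
  exists, in which case it is \<open>\<infinity>\<close>.

  Let \<open>S\<close> be finite and odd independent with \<open>k\<close> elements. Its queens occupy \<open>k\<close> columns \<open>X\<close>,
  \<open>k\<close> rows \<open>Y\<close>, \<open>k\<close> diagonals \<open>D\<close> and \<open>k\<close> antidiagonals \<open>A\<close>, and a vertex outside \<open>S\<close> has as many
  neighbours in \<open>S\<close> as there are occupied lines through it. So no lattice point lies on
  exactly two occupied lines, and only the points of \<open>S\<close> lie on four. A diagonal and an antidiagonal
  may a priori cross at a half-integral point, where the hypothesis says nothing. Double counting
  of the crossings excludes this (\<open>diagonals_cross_in_lattice\<close>), so the occupied lines form a
  finite arrangement without double points.

  For \<open>k \<ge> 2\<close> this contradicts the dual of the Sylvester--Gallai theorem, applied to these lines and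
  the line at infinity. For four directions there is a short proof by descent on right isosceles
  triangles formed by lines of the arrangement. Take a triangle with horizontal and vertical legs
  of length \<open>m\<close>. If no triangle has a horizontal or vertical hypotenuse of length \<open>m\<close>, then through
  every corner of the given triangle there is a line parallel to the opposite side; this repeats
  for the triangles so obtained, and the arrangement contains infinitely many lines
  (\<open>diag_leg_imp_hypotenuse\<close>). Hence some triangle has an axis-parallel hypotenuse of length \<open>m\<close>.
  Rotation by 45 degrees turns this into the statement that some triangle has axis-parallel legs
  of length \<open>m / 2\<close>, and so on forever (\<open>no_proper_triangle\<close>). With
  at least two queens there is a triangle to start from.\<close>

section \<open>Line arrangements in four directions\<close>

text \<open>The sets \<open>X\<close>, \<open>Y\<close>, \<open>D\<close>, \<open>A\<close> stand for the vertical lines \<open>x = c\<close>, the horizontal lines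
  \<open>y = c\<close>, the diagonals \<open>x - y = c\<close> and the antidiagonals \<open>x + y = c\<close>, given by their constants \<open>c\<close>.
  The predicate says that wherever two lines of different directions cross, also at a
  half-integral point, a line of a third direction passes. The last conjunct is written
  without division, so that a diagonal and an antidiagonal of different parity violate it.\<close>

definition no_double_points :: "int set \<Rightarrow> int set \<Rightarrow> int set \<Rightarrow> int set \<Rightarrow> bool" where
  "no_double_points X Y D A \<longleftrightarrow>
     (\<forall>x\<in>X. \<forall>y\<in>Y. x - y \<in> D \<or> x + y \<in> A) \<and>
     (\<forall>x\<in>X. \<forall>u\<in>D. x - u \<in> Y \<or> 2 * x - u \<in> A) \<and>
     (\<forall>x\<in>X. \<forall>v\<in>A. v - x \<in> Y \<or> 2 * x - v \<in> D) \<and>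
     (\<forall>y\<in>Y. \<forall>u\<in>D. u + y \<in> X \<or> u + 2 * y \<in> A) \<and>
     (\<forall>y\<in>Y. \<forall>v\<in>A. v - y \<in> X \<or> v - 2 * y \<in> D) \<and>
     (\<forall>u\<in>D. \<forall>v\<in>A. (\<exists>x\<in>X. 2 * x = u + v) \<or> (\<exists>y\<in>Y. 2 * y = v - u))"

text \<open>Three lines of different directions, two of them axis-parallel, bound a right isosceles
  triangle with axis-parallel legs of length \<open>m\<close>; it degenerates to a point if \<open>m = 0\<close>.\<close>

definition has_leg :: "int set \<Rightarrow> int set \<Rightarrow> int set \<Rightarrow> int set \<Rightarrow> int \<Rightarrow> bool" where
  "has_leg X Y D A m \<longleftrightarrow>
     (\<exists>x\<in>X. \<exists>y\<in>Y. \<exists>u\<in>D. m = \<bar>x - y - u\<bar>) \<or> (\<exists>x\<in>X. \<exists>y\<in>Y. \<exists>v\<in>A. m = \<bar>x + y - v\<bar>)"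

text \<open>A diagonal, an antidiagonal and an axis-parallel line bound a right isosceles triangle whose
  hypotenuse, of length \<open>m\<close>, lies on the axis-parallel line.\<close>

definition has_hypotenuse :: "int set \<Rightarrow> int set \<Rightarrow> int set \<Rightarrow> int set \<Rightarrow> int \<Rightarrow> bool" where
  "has_hypotenuse X Y D A m \<longleftrightarrow>
     (\<exists>x\<in>X. \<exists>u\<in>D. \<exists>v\<in>A. m = \<bar>2 * x - u - v\<bar>) \<or> (\<exists>y\<in>Y. \<exists>u\<in>D. \<exists>v\<in>A. m = \<bar>2 * y + u - v\<bar>)"

text \<open>Reflection in the horizontal axis exchanges diagonals and antidiagonals.\<close>

lemma no_double_points_reflect:
  assumes "no_double_points X Y D A"
  shows "no_double_points X (uminus ` Y) A D"
proof -
  have neg: "t \<in> uminus ` Y \<longleftrightarrow> - t \<in> Y" for t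
    by (metis image_iff minus_minus)
  have "(\<exists>x\<in>X. 2 * x = u + v) \<or> (\<exists>y\<in>Y. 2 * (- y) = v - u)" if "u \<in> A" "v \<in> D" for u v
  proof -
    have "(\<exists>x\<in>X. 2 * x = v + u) \<or> (\<exists>y\<in>Y. 2 * y = u - v)"
      using assms that unfolding no_double_points_def by blast
    then show ?thesis by (smt (verit))
  qed
  with assms show ?thesis
    unfolding no_double_points_def by (simp add: neg add.commute) blast
qed

lemma has_hypotenuse_reflect:
  assumes "has_hypotenuse X (uminus ` Y) A D m"
  shows "has_hypotenuse X Y D A m"
proof -
  consider x u v where "x \<in> X" "u \<in> D" "v \<in> A" "m = \<bar>2 * x - v - u\<bar>"
    | y u v where "y \<in> Y" "u \<in> D" "v \<in> A" "m = \<bar>2 * (- y) + v - u\<bar>"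
    using assms unfolding has_hypotenuse_def by blast
  then show ?thesis
  proof cases
    case 1
    then have "m = \<bar>2 * x - u - v\<bar>" by linarith
    with 1 show ?thesis unfolding has_hypotenuse_def by blast
  next
    case 2
    then have "m = \<bar>2 * y + u - v\<bar>" by linarith
    with 2 show ?thesis unfolding has_hypotenuse_def by blast
  qed
qed

text \<open>The map \<open>(x, y) \<mapsto> (x - y, x + y)\<close> rotates by 45 degrees and scales by \<open>\<surd>2\<close>. Diagonals
  become vertical, antidiagonals horizontal, rows diagonal and columns antidiagonal.\<close>

lemma no_double_points_rotate:
  assumes nd: "no_double_points X Y D A"
  shows "no_double_points D A ((\<lambda>y. - 2 * y) ` Y) ((\<lambda>x. 2 * x) ` X)"
proof -
  have "u - v \<in> (\<lambda>y. - 2 * y) ` Y \<or> u + v \<in> (\<lambda>x. 2 * x) ` X" if uv: "u \<in> D" "v \<in> A" for u v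
  proof -
    consider x where "x \<in> X" "2 * x = u + v" | y where "y \<in> Y" "2 * y = v - u"
      using nd uv unfolding no_double_points_def by blast
    then show ?thesis
    proof cases
      case 1
      then show ?thesis by (intro disjI2 image_eqI[of _ _ x]) auto
    next
      case 2
      then show ?thesis by (intro disjI1 image_eqI[of _ _ y]) auto
    qed
  qed
  moreover have "u - (- 2 * y) \<in> A \<or> 2 * u - (- 2 * y) \<in> (\<lambda>x. 2 * x) ` X" if "u \<in> D" "y \<in> Y" for u y
  proof -
    have "u + 2 * y \<in> A \<or> u + y \<in> X" using nd that unfolding no_double_points_def by blast
    then show ?thesis by (auto intro: image_eqI[of _ _ "u + y"])
  qed
  moreover have "2 * x - u \<in> A \<or> 2 * u - 2 * x \<in> (\<lambda>y. - 2 * y) ` Y" if "u \<in> D" "x \<in> X" for u x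
  proof -
    have "2 * x - u \<in> A \<or> x - u \<in> Y" using nd that unfolding no_double_points_def by blast
    then show ?thesis by (auto intro: image_eqI[of _ _ "x - u"])
  qed
  moreover have "- 2 * y + v \<in> D \<or> - 2 * y + 2 * v \<in> (\<lambda>x. 2 * x) ` X" if "v \<in> A" "y \<in> Y" for v y
  proof -
    have "v - 2 * y \<in> D \<or> v - y \<in> X" using nd that unfolding no_double_points_def by blast
    then show ?thesis by (auto intro: image_eqI[of _ _ "v - y"])
  qed
  moreover have "2 * x - v \<in> D \<or> 2 * x - 2 * v \<in> (\<lambda>y. - 2 * y) ` Y" if "v \<in> A" "x \<in> X" for v x
  proof -
    have "2 * x - v \<in> D \<or> v - x \<in> Y" using nd that unfolding no_double_points_def by blast
    then show ?thesis by (auto intro: image_eqI[of _ _ "v - x"])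
  qed
  moreover have "(\<exists>u\<in>D. 2 * u = - 2 * y + 2 * x) \<or> (\<exists>v\<in>A. 2 * v = 2 * x - (- 2 * y))"
    if "y \<in> Y" "x \<in> X" for x y
  proof -
    have "x - y \<in> D \<or> x + y \<in> A" using nd that unfolding no_double_points_def by blast
    then show ?thesis by (auto intro: bexI[of _ "x - y"] bexI[of _ "x + y"])
  qed
  ultimately show ?thesis
    unfolding no_double_points_def ball_simps(9) by (simp add: add.commute)
qed

lemma has_leg_rotate:
  "has_leg D A ((\<lambda>y. - 2 * y) ` Y) ((\<lambda>x. 2 * x) ` X) m \<longleftrightarrow> has_hypotenuse X Y D A m"
proof -
  have eq: "\<bar>u - v - (- 2 * y)\<bar> = \<bar>2 * y + u - v\<bar>" "\<bar>u + v - 2 * x\<bar> = \<bar>2 * x - u - v\<bar>" for x y u v :: int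
    by linarith+
  show ?thesis unfolding has_leg_def has_hypotenuse_def bex_simps by (simp only: eq) blast
qed

lemma has_hypotenuse_rotate:
  "has_hypotenuse D A ((\<lambda>y. - 2 * y) ` Y) ((\<lambda>x. 2 * x) ` X) m \<longleftrightarrow> (\<exists>l. has_leg X Y D A l \<and> m = 2 * l)"
proof -
  have eq: "\<bar>2 * u - (- 2 * y) - 2 * x\<bar> = 2 * \<bar>x - y - u\<bar>" "\<bar>2 * v + (- 2 * y) - 2 * x\<bar> = 2 * \<bar>x + y - v\<bar>"
    for x y u v :: int
    by (auto simp: abs_if)
  show ?thesis unfolding has_leg_def has_hypotenuse_def bex_simps by (simp only: eq) blast
qed

text \<open>The triangle has corners \<open>(x, y)\<close>, \<open>(x, x - u)\<close> and \<open>(u + y, y)\<close>. Without a hypotenuse of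
  length \<open>m\<close>, the third line through each corner is parallel to the opposite side. The same holds
  for the neighbouring triangle on the lines \<open>x - m'\<close>, \<open>y\<close>, \<open>x - y\<close>, where
  \<open>m' = x - y - u\<close> is the signed leg, and together the two steps translate the
  corner \<open>(x, y)\<close> by \<open>(- m', - m')\<close>.\<close>

lemma diag_leg_imp_hypotenuse:
  assumes nd: "no_double_points X Y D A" and fin: "finite X"
    and xyu: "x \<in> X" "y \<in> Y" "u \<in> D" and m: "x - y \<noteq> u"
  shows "has_hypotenuse X Y D A \<bar>x - y - u\<bar>"
proof (rule ccontr)
  assume nh: "\<not> ?thesis"
  have par: "a - b \<in> D \<and> a - c \<in> Y \<and> c + b \<in> X"
    if "a \<in> X" "b \<in> Y" "c \<in> D" and size: "\<bar>a - b - c\<bar> = \<bar>x - y - u\<bar>" for a b c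
  proof -
    have noX: "\<bar>2 * a - c' - v\<bar> \<noteq> \<bar>a - b - c\<bar>" if "c' \<in> D" "v \<in> A" for c' v
      using nh that \<open>a \<in> X\<close> size unfolding has_hypotenuse_def by metis
    have noY: "\<bar>2 * b + c' - v\<bar> \<noteq> \<bar>a - b - c\<bar>" if "c' \<in> D" "v \<in> A" for c' v
      using nh that \<open>b \<in> Y\<close> size unfolding has_hypotenuse_def by metis
    have "a + b \<notin> A" using noX[OF \<open>c \<in> D\<close>, of "a + b"] by auto
    then have d: "a - b \<in> D" using nd that unfolding no_double_points_def by blast
    have "2 * a - c \<notin> A" using noX[OF d, of "2 * a - c"] by auto
    then have "a - c \<in> Y" using nd that unfolding no_double_points_def by blast
    moreover have "c + 2 * b \<notin> A" using noY[OF d, of "c + 2 * b"] by auto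
    then have "c + b \<in> X" using nd that unfolding no_double_points_def by blast
    ultimately show ?thesis using d by blast
  qed
  define s where "s = x - y - u"
  have "s \<noteq> 0" using m by (simp add: s_def)
  have walk: "x - int n * s \<in> X \<and> y - int n * s \<in> Y" for n
  proof (induction n)
    case (Suc n)
    define a where "a = x - int n * s"
    define b where "b = y - int n * s"
    have ab: "a \<in> X" "b \<in> Y" "a - b - u = s"
      using Suc by (simp_all add: a_def b_def s_def)
    have 1: "a - b \<in> D" "u + b \<in> X"
      using par[OF ab(1,2) xyu(3)] ab(3) by (simp_all add: s_def)
    have "\<bar>(u + b) - b - (a - b)\<bar> = \<bar>x - y - u\<bar>" using ab(3) by (simp add: s_def)
    then have 2: "(u + b) - (a - b) \<in> Y" using par[OF 1(2) ab(2) 1(1)] by blast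
    have 3: "y - int (Suc n) * s = (u + b) - (a - b)" "x - int (Suc n) * s = u + b"
      using ab(3) unfolding a_def b_def of_nat_Suc distrib_right by linarith+
    show ?case unfolding 3 using 1(2) 2 ..
  qed (use xyu in auto)
  have "inj (\<lambda>n. x - int n * s)" using \<open>s \<noteq> 0\<close> by (auto intro: injI)
  then have "infinite (range (\<lambda>n. x - int n * s))" by (rule range_inj_infinite)
  moreover have "range (\<lambda>n. x - int n * s) \<subseteq> X" using walk by blast
  ultimately show False using fin finite_subset by blast
qed

lemma leg_imp_hypotenuse:
  assumes "no_double_points X Y D A" "finite X" "has_leg X Y D A m" "m \<noteq> 0"
  shows "has_hypotenuse X Y D A m"
proof -
  consider x y u where "x \<in> X" "y \<in> Y" "u \<in> D" "m = \<bar>x - y - u\<bar>"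
    | x y v where "x \<in> X" "y \<in> Y" "v \<in> A" "m = \<bar>x + y - v\<bar>"
    using assms(3) unfolding has_leg_def by blast
  then show ?thesis
  proof cases
    case 1
    then show ?thesis using diag_leg_imp_hypotenuse[OF assms(1,2)] assms(4) by auto
  next
    case 2
    then have "has_hypotenuse X (uminus ` Y) A D \<bar>x - (- y) - v\<bar>"
      using assms(4)
      by (intro diag_leg_imp_hypotenuse[OF no_double_points_reflect[OF assms(1)] assms(2)]) auto
    then have "has_hypotenuse X Y D A \<bar>x - (- y) - v\<bar>" by (rule has_hypotenuse_reflect)
    then show ?thesis using 2 by simp
  qed
qed

lemma no_proper_triangle:
  assumes nd: "no_double_points X Y D A" and fin: "finite X" "finite D"
    and "has_leg X Y D A m"
  shows "m = 0"
  using assms(4)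
proof (induction "nat m" arbitrary: m rule: less_induct)
  case less
  show ?case
  proof (rule ccontr)
    assume "m \<noteq> 0"
    have "m \<ge> 0" using less.prems unfolding has_leg_def by auto
    have "has_hypotenuse X Y D A m"
      using leg_imp_hypotenuse[OF nd fin(1) less.prems \<open>m \<noteq> 0\<close>] .
    then have "has_hypotenuse D A ((\<lambda>y. - 2 * y) ` Y) ((\<lambda>x. 2 * x) ` X) m"
      using leg_imp_hypotenuse[OF no_double_points_rotate[OF nd] fin(2)] \<open>m \<noteq> 0\<close>
      by (simp only: has_leg_rotate)
    then obtain l where "has_leg X Y D A l" "m = 2 * l"
      unfolding has_hypotenuse_rotate by blast
    then show False using less.hyps[of l] \<open>m \<noteq> 0\<close> \<open>m \<ge> 0\<close> by auto
  qed
qed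

section \<open>The lines occupied by an odd independent set\<close>

text \<open>The constants of the diagonal and of the antidiagonal through a point.\<close>

definition diag :: "int \<times> int \<Rightarrow> int" where "diag p = fst p - snd p"

definition anti :: "int \<times> int \<Rightarrow> int" where "anti p = fst p + snd p"

lemma queen_adj_iff:
  "queen_adj p q \<longleftrightarrow> p \<noteq> q \<and> (fst p = fst q \<or> snd p = snd q \<or> diag p = diag q \<or> anti p = anti q)"
  by (cases p; cases q) (auto simp: diag_def anti_def)

context
  fixes S :: "(int \<times> int) set"
  assumes odd: "odd_independent_set queen_vertices queen_adj S"
begin

lemma inj_on_S: "inj_on fst S" "inj_on snd S" "inj_on diag S" "inj_on anti S"
  using odd unfolding odd_independent_set_def independent_set_def inj_on_def queen_adj_iff
  by blast+

lemma lines_in_S: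
  assumes "s \<in> S"
  shows "fst s \<in> fst ` S" "snd s \<in> snd ` S" "diag s \<in> diag ` S" "anti s \<in> anti ` S"
  using assms by auto

text \<open>Each occupied line through \<open>p\<close> carries exactly one queen, and different lines carry
  different ones, since two lines meet in \<open>p\<close> only.\<close>

lemma card_neighbours:
  assumes "p \<notin> S"
  shows "card (open_neighborhood queen_vertices queen_adj p \<inter> S) =
    of_bool (fst p \<in> fst ` S) + of_bool (snd p \<in> snd ` S) +
    of_bool (diag p \<in> diag ` S) + of_bool (anti p \<in> anti ` S)"
proof -
  define L :: "(int \<times> int \<Rightarrow> int) \<Rightarrow> (int \<times> int) set" where "L f = {s \<in> S. f s = f p}" for f
  have L: "finite (L f) \<and> card (L f) = of_bool (f p \<in> f ` S)" if "inj_on f S" for f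
  proof (cases "f p \<in> f ` S")
    case True
    then obtain s where "s \<in> S" "f p = f s" by blast
    then have "L f = {s}" using that unfolding L_def inj_on_def by auto
    then show ?thesis using True by simp
  next
    case False
    then have "f s \<noteq> f p" if "s \<in> S" for s using that by (metis image_eqI)
    then have "L f = {}" unfolding L_def by blast
    then show ?thesis using False by simp
  qed
  have U: "open_neighborhood queen_vertices queen_adj p \<inter> S = L fst \<union> L snd \<union> L diag \<union> L anti"
    using assms unfolding open_neighborhood_def L_def queen_vertices_def queen_adj_iff by auto
  have two: "q = p"
    if "(fst q = fst p \<and> (snd q = snd p \<or> diag q = diag p \<or> anti q = anti p)) \<or>
      (snd q = snd p \<and> (diag q = diag p \<or> anti q = anti p)) \<or> (diag q = diag p \<and> anti q = anti p)" for q
    using that unfolding diag_def anti_def prod_eq_iff by arith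
  have "(L fst \<union> L snd \<union> L diag) \<inter> L anti = {}" "(L fst \<union> L snd) \<inter> L diag = {}" "L fst \<inter> L snd = {}"
    using assms two unfolding L_def by blast+
  then show ?thesis unfolding U using L inj_on_S by (simp add: card_Un_disjoint)
qed

lemma occupied_lines_odd:
  assumes "p \<notin> S"
  shows "(fst p \<notin> fst ` S \<and> snd p \<notin> snd ` S \<and> diag p \<notin> diag ` S \<and> anti p \<notin> anti ` S) \<or>
    (fst p \<in> fst ` S) \<noteq> ((snd p \<in> snd ` S) \<noteq> ((diag p \<in> diag ` S) \<noteq> (anti p \<in> anti ` S)))"
proof -
  let ?N = "open_neighborhood queen_vertices queen_adj p \<inter> S"
  have "?N = {} \<or> odd (card ?N)"
    using odd assms unfolding odd_independent_set_def queen_vertices_def by blast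
  then have "card ?N = 0 \<or> odd (card ?N)" by auto
  then show ?thesis
    unfolding card_neighbours[OF assms]
    by (cases "fst p \<in> fst ` S"; cases "snd p \<in> snd ` S"; cases "diag p \<in> diag ` S";
        cases "anti p \<in> anti ` S"; simp only: of_bool_eq; simp)
qed

lemma third_line:
  shows "fst p \<in> fst ` S \<Longrightarrow> snd p \<in> snd ` S \<Longrightarrow> diag p \<in> diag ` S \<or> anti p \<in> anti ` S"
    and "fst p \<in> fst ` S \<Longrightarrow> diag p \<in> diag ` S \<Longrightarrow> snd p \<in> snd ` S \<or> anti p \<in> anti ` S"
    and "fst p \<in> fst ` S \<Longrightarrow> anti p \<in> anti ` S \<Longrightarrow> snd p \<in> snd ` S \<or> diag p \<in> diag ` S"
    and "snd p \<in> snd ` S \<Longrightarrow> diag p \<in> diag ` S \<Longrightarrow> fst p \<in> fst ` S \<or> anti p \<in> anti ` S"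
    and "snd p \<in> snd ` S \<Longrightarrow> anti p \<in> anti ` S \<Longrightarrow> fst p \<in> fst ` S \<or> diag p \<in> diag ` S"
    and "diag p \<in> diag ` S \<Longrightarrow> anti p \<in> anti ` S \<Longrightarrow> fst p \<in> fst ` S \<or> snd p \<in> snd ` S"
  using lines_in_S[of p] occupied_lines_odd[of p] by argo+

lemma four_lines:
  "fst p \<in> fst ` S \<and> snd p \<in> snd ` S \<and> diag p \<in> diag ` S \<and> anti p \<in> anti ` S \<longleftrightarrow> p \<in> S"
  using lines_in_S[of p] occupied_lines_odd[of p] by argo

end

lemma card_crossings:
  assumes "bij (\<lambda>p. (f p, g p))" "finite F" "finite G"
  shows "finite {p. f p \<in> F \<and> g p \<in> G}" "card {p. f p \<in> F \<and> g p \<in> G} = card F * card G"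
proof -
  have *: "{p. f p \<in> F \<and> g p \<in> G} = (\<lambda>p. (f p, g p)) -` (F \<times> G)" by auto
  show "finite {p. f p \<in> F \<and> g p \<in> G}"
    unfolding * using assms by (intro finite_vimageI) (auto simp: bij_def)
  show "card {p. f p \<in> F \<and> g p \<in> G} = card F * card G"
    unfolding * using assms card_vimage_inj[of "\<lambda>p. (f p, g p)" "F \<times> G"]
    by (simp add: bij_def card_cartesian_product)
qed

text \<open>Let \<open>k = card S\<close>, and write \<open>N(XYD)\<close> for the number of points on an occupied column, an
  occupied row and an occupied diagonal, and similarly for the other triples of directions. Each
  crossing of a column and a row is counted in \<open>N(XYD)\<close> or \<open>N(XYA)\<close>, and exactly the \<open>k\<close> points
  of \<open>S\<close> in both, so \<open>N(XYD) + N(XYA) = k\<^sup>2 + k\<close>. In the same way \<open>N(XYD) + N(XDA) = k\<^sup>2 + k\<close> and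
  \<open>N(XYA) + N(YDA) = k\<^sup>2 + k\<close>, hence \<open>N(XDA) + N(YDA) = k\<^sup>2 + k\<close>. So the number of lattice points
  on an occupied diagonal and an occupied antidiagonal is \<open>k\<^sup>2\<close>, that is, all these pairs of lines cross in one.\<close>

lemma diagonals_cross_in_lattice:
  assumes odd: "odd_independent_set queen_vertices queen_adj S" and fin: "finite S"
    and "u \<in> diag ` S" "v \<in> anti ` S"
  shows "\<exists>p. diag p = u \<and> anti p = v"
proof -
  let ?X = "fst ` S" and ?Y = "snd ` S" and ?D = "diag ` S" and ?A = "anti ` S"
  define k where "k = card S"
  note inj = inj_on_S[OF odd] and third = third_line[OF odd] and four = four_lines[OF odd]
  have k: "card ?X = k" "card ?Y = k" "card ?D = k" "card ?A = k"
    using inj by (simp_all add: card_image k_def)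
  define XY where "XY = {p. fst p \<in> ?X \<and> snd p \<in> ?Y}"
  define XD where "XD = {p. fst p \<in> ?X \<and> diag p \<in> ?D}"
  define YA where "YA = {p. snd p \<in> ?Y \<and> anti p \<in> ?A}"
  define DA where "DA = {p. diag p \<in> ?D \<and> anti p \<in> ?A}"
  have "bij (\<lambda>p :: int \<times> int. (fst p, snd p))" by (simp add: bij_def inj_def)
  then have XY: "finite XY" "card XY = k * k"
    using card_crossings[of fst snd ?X ?Y] fin k by (simp_all add: XY_def)
  have "bij (\<lambda>p. (fst p, diag p))"
    by (rule o_bij[where g = "\<lambda>(x, u). (x, x - u)"]) (auto simp: fun_eq_iff diag_def)
  then have XD: "finite XD" "card XD = k * k"
    using card_crossings[of fst diag ?X ?D] fin k by (simp_all add: XD_def)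
  have "bij (\<lambda>p. (snd p, anti p))"
    by (rule o_bij[where g = "\<lambda>(y, v). (v - y, y)"]) (auto simp: fun_eq_iff anti_def)
  then have YA: "finite YA" "card YA = k * k"
    using card_crossings[of snd anti ?Y ?A] fin k by (simp_all add: YA_def)
  have injDA: "inj_on (\<lambda>p. (diag p, anti p)) DA"
    by (auto simp: inj_on_def diag_def anti_def)
  have subDA: "(\<lambda>p. (diag p, anti p)) ` DA \<subseteq> ?D \<times> ?A" by (auto simp: DA_def)
  then have finDA: "finite DA" using injDA fin by (meson finite_SigmaI finite_imageI inj_on_finite)
  have "XY = XY \<inter> XD \<union> XY \<inter> YA" "XD = XY \<inter> XD \<union> XD \<inter> DA" "YA = XY \<inter> YA \<union> YA \<inter> DA"
    "DA = XD \<inter> DA \<union> YA \<inter> DA"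
    using third unfolding XY_def XD_def YA_def DA_def by blast+
  moreover have "(XY \<inter> XD) \<inter> (XY \<inter> YA) = S" "(XY \<inter> XD) \<inter> (XD \<inter> DA) = S"
    "(XY \<inter> YA) \<inter> (YA \<inter> DA) = S" "(XD \<inter> DA) \<inter> (YA \<inter> DA) = S"
    using four unfolding XY_def XD_def YA_def DA_def by blast+
  ultimately have "card XY + k = card (XY \<inter> XD) + card (XY \<inter> YA)"
    "card XD + k = card (XY \<inter> XD) + card (XD \<inter> DA)"
    "card YA + k = card (XY \<inter> YA) + card (YA \<inter> DA)"
    "card DA + k = card (XD \<inter> DA) + card (YA \<inter> DA)"
    using card_Un_Int[of "XY \<inter> XD" "XY \<inter> YA"] card_Un_Int[of "XY \<inter> XD" "XD \<inter> DA"]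
      card_Un_Int[of "XY \<inter> YA" "YA \<inter> DA"] card_Un_Int[of "XD \<inter> DA" "YA \<inter> DA"]
      XY XD YA finDA by (simp_all add: k_def)
  then have "card DA = k * k" using XY XD YA by linarith
  then have "card ((\<lambda>p. (diag p, anti p)) ` DA) = card (?D \<times> ?A)"
    using k injDA by (simp add: card_image card_cartesian_product)
  then have "(\<lambda>p. (diag p, anti p)) ` DA = ?D \<times> ?A"
    using subDA fin by (intro card_subset_eq) auto
  moreover have "(u, v) \<in> ?D \<times> ?A" using assms(3,4) by blast
  ultimately show ?thesis by (metis (no_types, lifting) imageE prod.inject)
qed

lemma no_double_points_of_odd_independent:
  assumes odd: "odd_independent_set queen_vertices queen_adj S" and fin: "finite S"
  shows "no_double_points (fst ` S) (snd ` S) (diag ` S) (anti ` S)"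
proof -
  let ?X = "fst ` S" and ?Y = "snd ` S" and ?D = "diag ` S" and ?A = "anti ` S"
  show ?thesis
    unfolding no_double_points_def
  proof (intro conjI ballI)
    show "x - y \<in> ?D \<or> x + y \<in> ?A" if "x \<in> ?X" "y \<in> ?Y" for x y
      using third_line(1)[OF odd, of "(x, y)"] that by (simp add: diag_def anti_def)
    show "x - u \<in> ?Y \<or> 2 * x - u \<in> ?A" if "x \<in> ?X" "u \<in> ?D" for x u
      using third_line(2)[OF odd, of "(x, x - u)"] that by (simp add: diag_def anti_def)
    show "v - x \<in> ?Y \<or> 2 * x - v \<in> ?D" if "x \<in> ?X" "v \<in> ?A" for x v
      using third_line(3)[OF odd, of "(x, v - x)"] that by (simp add: diag_def anti_def)
    show "u + y \<in> ?X \<or> u + 2 * y \<in> ?A" if "y \<in> ?Y" "u \<in> ?D" for y u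
      using third_line(4)[OF odd, of "(u + y, y)"] that by (simp add: diag_def anti_def add.assoc)
    show "v - y \<in> ?X \<or> v - 2 * y \<in> ?D" if "y \<in> ?Y" "v \<in> ?A" for y v
      using third_line(5)[OF odd, of "(v - y, y)"] that by (simp add: diag_def anti_def)
    show "(\<exists>x\<in>?X. 2 * x = u + v) \<or> (\<exists>y\<in>?Y. 2 * y = v - u)" if uv: "u \<in> ?D" "v \<in> ?A" for u v
    proof -
      obtain p where p: "diag p = u" "anti p = v"
        using diagonals_cross_in_lattice[OF odd fin uv] by blast
      have "fst p \<in> ?X \<or> snd p \<in> ?Y"
        using third_line(6)[OF odd, of p] uv unfolding p by blast
      moreover have "2 * fst p = u + v" "2 * snd p = v - u"
        using p by (auto simp: diag_def anti_def)
      ultimately show ?thesis by blast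
    qed
  qed
qed

section \<open>Finite odd independent sets\<close>

lemma finite_odd_independent_card_le_1:
  assumes odd: "odd_independent_set queen_vertices queen_adj S" and fin: "finite S"
  shows "card S \<le> 1"
proof -
  have "s = t" if st: "s \<in> S" "t \<in> S" for s t
  proof -
    \<comment> \<open>The column and the diagonal of \<open>s\<close> together with the row of \<open>t\<close> bound a triangle.\<close>
    have "has_leg (fst ` S) (snd ` S) (diag ` S) (anti ` S) \<bar>fst s - snd t - diag s\<bar>"
      using st unfolding has_leg_def by blast
    then have "\<bar>fst s - snd t - diag s\<bar> = 0"
      using no_proper_triangle[OF no_double_points_of_odd_independent[OF odd fin]] fin by blast
    then have "snd s = snd t" by (simp add: diag_def)
    then show "s = t" using inj_on_S(2)[OF odd] st by (auto dest: inj_onD)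
  qed
  then show ?thesis using fin by (metis One_nat_def card_le_Suc0_iff_eq)
qed

lemma odd_independent_singleton: "odd_independent_set queen_vertices queen_adj {s}"
proof -
  have "B \<inter> {s} = {} \<or> odd (card (B \<inter> {s}))" for B :: "(int \<times> int) set"
    by (cases "s \<in> B") auto
  then show ?thesis
    by (simp add: odd_independent_set_def independent_set_def queen_vertices_def queen_adj_irrefl)
qed

theorem proposition23:
  "odd_independence_number queen_vertices queen_adj = \<infinity> \<or>
   odd_independence_number queen_vertices queen_adj = 1"
proof (cases "odd_independence_number queen_vertices queen_adj = \<infinity>")
  case False
  then obtain S where S: "odd_independent_set queen_vertices queen_adj S" "finite S"
    and max: "odd_independence_number queen_vertices queen_adj = enat (card S)"
    using odd_independence_number_attained by blast
  have "ecard {(0, 0) :: int \<times> int} \<le> odd_independence_number queen_vertices queen_adj"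
    unfolding odd_independence_number_def by (rule SUP_upper) (simp add: odd_independent_singleton)
  then have "1 \<le> card S" by (simp add: max ecard_def one_enat_def)
  with finite_odd_independent_card_le_1[OF S] have "card S = 1" by simp
  then show ?thesis by (simp add: max one_enat_def)
qed simp

end
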